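(* Let $p$ be a prime, $L\ge 0$ an integer and $j\in\{1,2,\ldots,p-1\}$, and let $s^{(j)}_0,s^{(j)}_1,\ldots,s^{(j)}_{p-1}$ be the first $p$ terms of the binomial sequence $\left\{\binom{n}{j}\right\}$ modulo $p$. Then: (a) The sequence $\left\{\binom{n}{j\cdot p^L}\right\}$ modulo $p$ is the periodic repetition of the block of length $p^{L+1}$ $$\Big\{\underbrace{s^{(j)}_0\ldots s^{(j)}_0}_{p^{L}}, \underbrace{s^{(j)}_1\ldots s^{(j)}_1}_{p^{L}}, \ldots, \underbrace{s^{(j)}_{p-1}\ldots s^{(j)}_{p-1}}_{p^{L}}\Big\}.$$ (b) For every $i\in\{1,2,\ldots,L\}$ and every integer $r$ with $p^{i-1}\le r<p^{i}$, let $\beta_r=\left(\binom{0}{r},\binom{1}{r},\ldots,\binom{p^i-1}{r}\right)\bmod p$ be the first $p^i$ terms (one period) of $\left\{\binom{n}{r}\right\}$ modulo $p$. Then the sequence $\left\{\binom{n}{j\cdot p^L+r}\right\}$ modulo $p$ is the periodic repetition of the block of length $p^{L+1}$ $$\Big\{\underbrace{s^{(j)}_0 \beta_r,\ldots,s^{(j)}_0 \beta_r}_{p^{L-i}\text{ copies}},\ \underbrace{s^{(j)}_1 \beta_r,\ldots,s^{(j)}_1 \beta_r}_{p^{L-i}\text{ copies}},\ \ldots,\ \underbrace{s^{(j)}_{p-1} \beta_r,\ldots,s^{(j)}_{p-1} \beta_r}_{p^{L-i}\text{ copies}}\Big\}.$$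
   Context: For an integer $m\ge 0$, $\left\{\binom{n}{m}\right\}=\left\{\binom{n}{m}\right\}_{n\ge0}$ denotes the $m$-th ($p$-ary) binomial sequence, i.e. the sequence over $\mathbb{F}_p$ with $n$-th term $\binom{n}{m}\bmod p$ (and $\binom{n}{m}=0$ for $n<m$). Blocks are concatenated, and a scalar times a block multiplies every entry of the block in $\mathbb{F}_p$. *)

theory Defs
  imports "HOL-Computational_Algebra.Primes"
begin

text \<open>
  The field with \<open>p\<close> elements is represented by the canonical residues \<open>0, \<dots>, p - 1\<close> in
  \<^typ>\<open>nat\<close>, with arithmetic modulo \<open>p\<close>.  Sequences are functions on \<^typ>\<open>nat\<close>, blocks are lists.
\<close>

definition binom_seq :: "nat \<Rightarrow> nat \<Rightarrow> nat \<Rightarrow> nat" where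
  "binom_seq p m n = (n choose m) mod p"

definition first_terms :: "nat \<Rightarrow> (nat \<Rightarrow> 'a) \<Rightarrow> 'a list" where
  "first_terms N f = map f [0..<N]"

definition scale_block :: "nat \<Rightarrow> nat \<Rightarrow> nat list \<Rightarrow> nat list" where
  "scale_block p c B = map (\<lambda>x. (c * x) mod p) B"

text \<open>The length of \<open>B\<close> is a period of \<open>f\<close>, not necessarily the least one.\<close>

definition periodic_repetition :: "(nat \<Rightarrow> 'a) \<Rightarrow> 'a list \<Rightarrow> bool" where
  "periodic_repetition f B \<longleftrightarrow> B \<noteq> [] \<and> (\<forall>n. f n = B ! (n mod length B))"

definition run_block :: "nat \<Rightarrow> nat \<Rightarrow> nat \<Rightarrow> nat list" where
  "run_block p L j =
     concat (map (\<lambda>c. replicate (p ^ L) c) (first_terms p (binom_seq p j)))"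

definition beta_block :: "nat \<Rightarrow> nat \<Rightarrow> nat \<Rightarrow> nat list" where
  "beta_block p i r = first_terms (p ^ i) (binom_seq p r)"

definition copies_block :: "nat \<Rightarrow> nat \<Rightarrow> nat \<Rightarrow> nat \<Rightarrow> nat \<Rightarrow> nat list" where
  "copies_block p L j i r =
     concat (map (\<lambda>c. concat (replicate (p ^ (L - i)) (scale_block p c (beta_block p i r))))
                 (first_terms p (binom_seq p j)))"

end

theory Submission
  imports Defs "HOL-Number_Theory.Cong"
begin

text \<open>
  Everything rests on a Lucas-type congruence for \<open>q = p ^ L\<close>: if \<open>b, d < q\<close>, then
  \<open>(a * q + b choose c * q + d)\<close> is congruent to \<open>(a choose c) * (b choose d)\<close> modulo \<open>p\<close>.  Since
  \<open>p\<close> divides \<open>(q choose k)\<close> for \<open>0 < k < q\<close>, Vandermonde's identity gives the Pascal-like rule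
  \<open>(q + n choose m) = (n choose m) + (n choose m - q)\<close> modulo \<open>p\<close>, from which the congruence follows
  by induction on \<open>a\<close>.
\<close>

text \<open>By absorption, \<open>p ^ L\<close> divides \<open>k * (p ^ L choose k)\<close>. If
  \<open>p\<close> did not divide the binomial coefficient, \<open>p ^ L\<close> would be coprime to
  it and would divide \<open>k\<close>, which is positive and too small.\<close>

lemma prime_dvd_prime_power_choose:
  fixes p :: nat
  assumes "prime p" "0 < k" "k < p ^ L"
  shows "p dvd (p ^ L choose k)"
proof (rule ccontr)
  assume "\<not> p dvd (p ^ L choose k)"
  then have "coprime (p ^ L) (p ^ L choose k)"
    using assms(1) by (simp add: prime_imp_coprime)
  moreover have "k * (p ^ L choose k) = p ^ L * ((p ^ L - 1) choose (k - 1))"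
    using times_binomial_minus1_eq[OF assms(2)] by simp
  then have "p ^ L dvd k * (p ^ L choose k)" by simp
  ultimately have "p ^ L dvd k"
    by (simp add: coprime_dvd_mult_left_iff)
  then show False using assms(2,3) by (simp add: nat_dvd_not_less)
qed

lemma choose_prime_power_add_cong:
  fixes p :: nat
  assumes "prime p"
  shows "[(p ^ L + n) choose m =
          (n choose m) + (if p ^ L \<le> m then n choose (m - p ^ L) else 0)] (mod p)"
proof -
  let ?q = "p ^ L"
  have q: "0 < ?q" using assms by (simp add: prime_gt_0_nat)
  \<comment> \<open>The two Vandermonde terms that survive modulo \<open>p\<close> are written as
    indicator summands, so that the sum collapses. The index \<open>?q\<close> lies in the range
    only if \<open>?q \<le> m\<close>, which yields the conditional and keeps truncated subtraction
    from producing a spurious term.\<close>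
  have "[(\<Sum>k\<le>m. (?q choose k) * (n choose (m - k))) =
         (\<Sum>k\<le>m. (if k = 0 then n choose m else 0) +
                 (if k = ?q then n choose (m - ?q) else 0))] (mod p)"
  proof (rule cong_sum)
    fix k
    consider "k = 0" | "k = ?q" | "0 < k" "k < ?q" | "?q < k" by linarith
    then show "[(?q choose k) * (n choose (m - k)) =
                (if k = 0 then n choose m else 0) +
                (if k = ?q then n choose (m - ?q) else 0)] (mod p)"
    proof cases
      case 3
      then have "[(?q choose k) * (n choose (m - k)) = 0] (mod p)"
        using prime_dvd_prime_power_choose[OF assms 3] by (simp add: cong_0_iff)
      with 3 show ?thesis by simp
    qed (use q in \<open>auto simp: binomial_eq_0\<close>)
  qed
  then show ?thesis by (simp add: vandermonde sum.distrib)
qed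

text \<open>The quotients \<open>a\<close> and \<open>c\<close> may be arbitrary, not just
  base-\<open>p\<close> digits. The induction needs \<open>c\<close> general because its step calls
  on both \<open>c\<close> and its predecessor.\<close>

lemma choose_lucas_cong:
  fixes p :: nat
  assumes "prime p" "b < p ^ L" "d < p ^ L"
  shows "[(a * p ^ L + b) choose (c * p ^ L + d) = (a choose c) * (b choose d)] (mod p)"
proof (induction a arbitrary: c)
  case 0
  have "b < c * p ^ L + d" if "0 < c"
    using that assms(2) by (cases c) auto
  then show ?case by (cases c) (auto simp: binomial_eq_0)
next
  case (Suc a)
  let ?q = "p ^ L" and ?N = "a * p ^ L + b"
  have step: "[(Suc a * ?q + b) choose (c * ?q + d) =
      (?N choose (c * ?q + d)) +
      (if ?q \<le> c * ?q + d then ?N choose (c * ?q + d - ?q) else 0)] (mod p)"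
    using choose_prime_power_add_cong[OF assms(1), of L ?N "c * ?q + d"]
    by (simp add: add.assoc)
  show ?case
  proof (cases c)
    case 0
    \<comment> \<open>Here the lower index is \<open>d < ?q\<close>, so the shifted term is
      absent.\<close>
    with step Suc.IH[of 0] assms(3) show ?thesis by (auto intro: cong_trans)
  next
    case (Suc c')
    have "[(Suc a * ?q + b) choose (c * ?q + d) =
        (?N choose (c * ?q + d)) + (?N choose (c' * ?q + d))] (mod p)"
      using step Suc by (simp add: add.assoc)
    also have "[(?N choose (c * ?q + d)) + (?N choose (c' * ?q + d)) =
        (a choose c) * (b choose d) + (a choose c') * (b choose d)] (mod p)"
      by (intro cong_add Suc.IH)
    \<comment> \<open>Factoring out \<open>b choose d\<close> leaves Pascal's rule for
      \<open>Suc a choose Suc c'\<close>.\<close>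
    finally show ?thesis using Suc by (simp add: algebra_simps)
  qed
qed

text \<open>This is the Lucas-type congruence with \<open>c = 0\<close>: the quotient contributes
  only the factor \<open>n div p ^ i choose 0\<close>, which is 1.\<close>

lemma binom_seq_mod_prime_power:
  assumes "prime p" "r < p ^ i"
  shows "binom_seq p r (n mod p ^ i) = binom_seq p r n"
proof -
  have "0 < p ^ i" using assms(1) by (simp add: prime_gt_0_nat)
  then show ?thesis
    using choose_lucas_cong[OF assms(1) _ assms(2), of "n mod p ^ i" "n div p ^ i" 0]
    by (simp add: binom_seq_def cong_def div_mult_mod_eq)
qed

lemma binom_seq_lucas:
  assumes "prime p" "j < p" "r < p ^ L"
  shows "binom_seq p (j * p ^ L + r) n =
         (binom_seq p j (n div p ^ L mod p) * binom_seq p r (n mod p ^ L)) mod p"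
proof -
  have "0 < p ^ L" using assms(1) by (simp add: prime_gt_0_nat)
  then have "binom_seq p (j * p ^ L + r) n =
        (binom_seq p j (n div p ^ L) * binom_seq p r (n mod p ^ L)) mod p"
    using choose_lucas_cong[OF assms(1) _ assms(3), of "n mod p ^ L" "n div p ^ L" j]
    by (simp add: binom_seq_def cong_def div_mult_mod_eq mod_mult_eq)
  then show ?thesis
    \<comment> \<open>Since \<open>j < p\<close>, the high factor has period \<open>p ^ 1\<close>,
      so its argument may be reduced modulo \<open>p\<close>.\<close>
    using binom_seq_mod_prime_power[of p j 1] assms(1,2) by simp
qed

lemma length_concat_map_uniform:
  assumes "\<And>x. x \<in> set xs \<Longrightarrow> length (B x) = q"
  shows "length (concat (map B xs)) = length xs * q"
  using assms by (induction xs) auto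

lemma nth_concat_map_uniform:
  assumes "\<And>x. x \<in> set xs \<Longrightarrow> length (B x) = q" "n < length xs * q"
  shows "concat (map B xs) ! n = B (xs ! (n div q)) ! (n mod q)"
  using assms
proof (induction xs arbitrary: n)
  case (Cons x xs)
  have "0 < q" using Cons.prems(2) by (cases q) auto
  show ?case
  proof (cases "n < q")
    case False
    then have "concat (map B xs) ! (n - q) = B (xs ! ((n - q) div q)) ! ((n - q) mod q)"
      using Cons.prems by (intro Cons.IH) auto
    then show ?thesis
      using False Cons.prems(1) \<open>0 < q\<close> by (simp add: nth_append le_div_geq le_mod_geq)
  qed (use Cons.prems in \<open>simp add: nth_append\<close>)
qed simp

text \<open>Common criterion for both parts of the theorem: each block there joins pieces of equal
  length \<open>q\<close>, one per entry of \<open>xs\<close>, so \<open>n\<close> is located by the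
  piece \<open>n div q mod length xs\<close> and the offset \<open>n mod q\<close>.\<close>

lemma periodic_repetition_concat_map:
  assumes "\<And>x. x \<in> set xs \<Longrightarrow> length (B x) = q" "xs \<noteq> []" "0 < q"
    and "\<And>n. f n = B (xs ! (n div q mod length xs)) ! (n mod q)"
  shows "periodic_repetition f (concat (map B xs))"
proof -
  have len: "length (concat (map B xs)) = length xs * q"
    using assms(1) by (rule length_concat_map_uniform)
  have "f n = concat (map B xs) ! (n mod (length xs * q))" for n
  proof -
    have "n mod (length xs * q) < length xs * q" using assms(2,3) by simp
    moreover have "n mod (length xs * q) = q * (n div q mod length xs) + n mod q"
      by (simp add: mult.commute[of "length xs"] mod_mult2_eq)
    ultimately show ?thesis
      using assms(3) by (simp add: nth_concat_map_uniform[OF assms(1)] assms(4))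
  qed
  moreover have "concat (map B xs) \<noteq> []"
    using len assms(2,3) by (metis length_0_conv mult_eq_0_iff less_irrefl)
  ultimately show ?thesis
    unfolding periodic_repetition_def len by blast
qed

lemma nth_concat_replicate:
  assumes "n < k * length B"
  shows "concat (replicate k B) ! n = B ! (n mod length B)"
proof -
  have "n div length B < k"
    using assms by (simp add: less_mult_imp_div_less)
  then show ?thesis
    using nth_concat_map_uniform[of "replicate k B" "\<lambda>x. x" "length B" n] assms by simp
qed

lemma length_first_terms [simp]: "length (first_terms N f) = N"
  by (simp add: first_terms_def)

lemma nth_first_terms [simp]: "n < N \<Longrightarrow> first_terms N f ! n = f n"
  by (simp add: first_terms_def)

lemma periodic_repetition_beta_block:
  assumes "prime p" "r < p ^ i"
  shows "periodic_repetition (binom_seq p r) (beta_block p i r)"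
proof -
  have "0 < p ^ i" using assms(1) by (simp add: prime_gt_0_nat)
  then show ?thesis
    using binom_seq_mod_prime_power[OF assms]
    by (auto simp: periodic_repetition_def beta_block_def simp flip: length_greater_0_conv)
qed

lemma length_run_block: "length (run_block p L j) = p ^ (L + 1)"
  using length_concat_map_uniform[of "first_terms p (binom_seq p j)" "replicate (p ^ L)" "p ^ L"]
  by (simp add: run_block_def)

lemma periodic_repetition_run_block:
  assumes "prime p" "j < p"
  shows "periodic_repetition (binom_seq p (j * p ^ L)) (run_block p L j)"
  unfolding run_block_def
proof (rule periodic_repetition_concat_map)
  have p: "0 < p" using assms(1) by (rule prime_gt_0_nat)
  then show "first_terms p (binom_seq p j) \<noteq> []" by (simp flip: length_greater_0_conv)
  show "0 < p ^ L" using p by simp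
  fix n
  show "binom_seq p (j * p ^ L) n = replicate (p ^ L) (first_terms p (binom_seq p j) !
      (n div p ^ L mod length (first_terms p (binom_seq p j)))) ! (n mod p ^ L)"
    \<comment> \<open>With \<open>r = 0\<close> the low factor is \<open>1 mod p\<close>, so only
      the high factor remains, constant along each run.\<close>
    using binom_seq_lucas[OF assms, of 0 L n] p by (simp add: binom_seq_def mod_mult_right_eq)
qed simp

lemma length_copies:
  assumes "i \<le> L"
  shows "length (concat (replicate (p ^ (L - i)) (scale_block p c (beta_block p i r)))) = p ^ L"
  using assms
  by (simp add: length_concat sum_list_replicate scale_block_def beta_block_def flip: power_add)

lemma length_copies_block:
  assumes "i \<le> L"
  shows "length (copies_block p L j i r) = p ^ (L + 1)"
  unfolding copies_block_def by (subst length_concat_map_uniform[OF length_copies[OF assms]]) simp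

text \<open>In the product formula at level \<open>L\<close>, the high factor selects the scalar and
  the low factor depends on \<open>n mod p ^ L\<close>. As \<open>r < p ^ i\<close>, the low factor
  already has period \<open>p ^ i\<close>, which is why each piece consists of copies of the shorter
  block.\<close>

lemma periodic_repetition_copies_block:
  assumes "prime p" "j < p" "i \<le> L" "r < p ^ i"
  shows "periodic_repetition (binom_seq p (j * p ^ L + r)) (copies_block p L j i r)"
  unfolding copies_block_def
proof (rule periodic_repetition_concat_map)
  have p: "0 < p" using assms(1) by (rule prime_gt_0_nat)
  then show "first_terms p (binom_seq p j) \<noteq> []" by (simp flip: length_greater_0_conv)
  show "0 < p ^ L" using p by simp
  fix n
  let ?s = "first_terms p (binom_seq p j)"
  let ?c = "binom_seq p j (n div p ^ L mod p)"
  let ?B = "scale_block p ?c (beta_block p i r)"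
  have lenB: "length ?B = p ^ i" by (simp add: scale_block_def beta_block_def)
  have "p ^ i \<le> p ^ L" using p assms(3) by (simp add: power_increasing)
  then have "r < p ^ L" using assms(4) by simp
  have pw: "p ^ (L - i) * p ^ i = p ^ L" using assms(3) by (simp flip: power_add)
  \<comment> \<open>The offset stays inside the \<open>p ^ (L - i)\<close> copies, since together
    they have length \<open>p ^ L\<close>.\<close>
  have "n mod p ^ L < p ^ (L - i) * length ?B" unfolding lenB pw using p by simp
  then have "concat (replicate (p ^ (L - i)) ?B) ! (n mod p ^ L) = ?B ! (n mod p ^ L mod p ^ i)"
    using nth_concat_replicate lenB by metis
  also have "\<dots> = (?c * binom_seq p r (n mod p ^ L)) mod p"
    using p binom_seq_mod_prime_power[OF assms(1,4)] by (simp add: scale_block_def beta_block_def)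
  also have "\<dots> = binom_seq p (j * p ^ L + r) n"
    using binom_seq_lucas[OF assms(1,2) \<open>r < p ^ L\<close>] by simp
  finally show "binom_seq p (j * p ^ L + r) n = concat (replicate (p ^ (L - i))
      (scale_block p (?s ! (n div p ^ L mod length ?s)) (beta_block p i r))) ! (n mod p ^ L)"
    using p by simp
qed (rule length_copies[OF assms(3)])

theorem theorem8:
  fixes p L j :: nat
  assumes "prime p" and "j \<in> {1..p - 1}"
  shows "(length (run_block p L j) = p ^ (L + 1) \<and>
          periodic_repetition (binom_seq p (j * p ^ L)) (run_block p L j)) \<and>
         (\<forall>i\<in>{1..L}. \<forall>r. p ^ (i - 1) \<le> r \<and> r < p ^ i \<longrightarrow>
            periodic_repetition (binom_seq p r) (beta_block p i r) \<and>
            length (copies_block p L j i r) = p ^ (L + 1) \<and>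
            periodic_repetition (binom_seq p (j * p ^ L + r)) (copies_block p L j i r))"
proof -
  have "j < p" using assms(2) by auto
  with assms(1) show ?thesis
    by (simp add: length_run_block periodic_repetition_run_block periodic_repetition_beta_block
        length_copies_block periodic_repetition_copies_block del: power_Suc)
qed

end
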